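(* Let $\Delta$ be a simplicial complex on vertex set $[n]$, and let $\Delta^\vee$ be its Alexander dual. (i) If $\Delta$ is skeleton-E-chordal, then $\Delta^\vee$ is vertex-decomposable. (ii) If $\Delta^\vee$ is vertex-decomposable, then $\Delta$ is skeleton-clique-chordal. In particular, for any subflag simplicial complex $\Delta$, $$\Delta \text{ is skeleton-E-chordal} \iff \Delta^\vee \text{ is vertex-decomposable}.$$
   Context: Simplicial complexes are finite and not necessarily pure. A vertex labeling of a complex with $n$ vertices is a bijection of its vertices with $[n]=\{1,\dots,n\}$; $\max f$ is the largest label in a face $f$; the size of a face is its number of vertices. $\Delta$ is skeleton-E-chordal if it has a vertex labeling such that for every two faces $f\neq g$ of $\Delta$ with the same size and the same maximum, every subset $h\subseteq f\cup g$ with $|h|=|f|$ is a face of $\Delta$. $\Delta$ is skeleton-clique-chordal if it has a vertex labeling such that for every two faces $f\ne g$ of $\Delta$ with the same size $\ge 2$ and the same maximum, every $2$-element subset of $f\cup g$ is a face of $\Delta$. A clique of $\Delta$ is a set of vertices any two of which span an edge of $\Delta$. $\Delta$ is subflag if every clique of size $\le \dim\Delta+1$ is a face of $\Delta$. The Alexander dual of $\Delta$ on vertex set $[n]$ is $\Delta^\vee=\{F\subseteq[n] : [n]\setminus F\notin\Delta\}$. A vertex $v$ of a complex $\Gamma$ is shedding if no facet of $\operatorname{link}(v,\Gamma)$ is also a facet of $\operatorname{del}(v,\Gamma)$, where $\operatorname{del}(v,\Gamma)$ is the subcomplex of all faces not containing $v$. A (not necessarily pure) complex $\Gamma$ is vertex-decomposable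 if it is a simplex, or $\Gamma=\{\emptyset\}$, or $\Gamma=\emptyset$, or (recursively) it has a shedding vertex $v$ such that $\operatorname{del}(v,\Gamma)$ and $\operatorname{link}(v,\Gamma)$ are both vertex-decomposable. *)

theory Defs
  imports Main
begin

definition abstract_simplicial_complex :: "'a set set \<Rightarrow> bool" where
  "abstract_simplicial_complex \<Delta> \<longleftrightarrow>
     finite \<Delta> \<and> (\<forall>F\<in>\<Delta>. finite F) \<and> (\<forall>F\<in>\<Delta>. \<forall>G. G \<subseteq> F \<longrightarrow> G \<in> \<Delta>)"

definition vertices :: "'a set set \<Rightarrow> 'a set" where
  "vertices \<Delta> = {v. {v} \<in> \<Delta>}"

text \<open>Every element of \<open>{1..n}\<close> is an actual vertex, i.e. its singleton is a face.\<close>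

definition complex_on :: "nat \<Rightarrow> nat set set \<Rightarrow> bool" where
  "complex_on n \<Delta> \<longleftrightarrow> abstract_simplicial_complex \<Delta> \<and> vertices \<Delta> = {1..n}"

definition vertex_labeling :: "'a set set \<Rightarrow> ('a \<Rightarrow> nat) \<Rightarrow> bool" where
  "vertex_labeling \<Delta> l \<longleftrightarrow> bij_betw l (vertices \<Delta>) {1..card (vertices \<Delta>)}"

text \<open>Two distinct faces of the same size are nonempty, so \<open>Max\<close> is never relevantly
  applied to the empty set in the next definition.\<close>

definition skeleton_E_chordal :: "'a set set \<Rightarrow> bool" where
  "skeleton_E_chordal \<Delta> \<longleftrightarrow>
     (\<exists>l. vertex_labeling \<Delta> l \<and>
        (\<forall>f\<in>\<Delta>. \<forall>g\<in>\<Delta>. f \<noteq> g \<and> card f = card g \<and> Max (l ` f) = Max (l ` g) \<longrightarrow>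
           (\<forall>h. h \<subseteq> f \<union> g \<and> card h = card f \<longrightarrow> h \<in> \<Delta>)))"

definition skeleton_clique_chordal :: "'a set set \<Rightarrow> bool" where
  "skeleton_clique_chordal \<Delta> \<longleftrightarrow>
     (\<exists>l. vertex_labeling \<Delta> l \<and>
        (\<forall>f\<in>\<Delta>. \<forall>g\<in>\<Delta>. f \<noteq> g \<and> card f = card g \<and> card f \<ge> 2 \<and> Max (l ` f) = Max (l ` g) \<longrightarrow>
           (\<forall>e. e \<subseteq> f \<union> g \<and> card e = 2 \<longrightarrow> e \<in> \<Delta>)))"

definition clique :: "'a set set \<Rightarrow> 'a set \<Rightarrow> bool" where
  "clique \<Delta> C \<longleftrightarrow> C \<subseteq> vertices \<Delta> \<and> (\<forall>u\<in>C. \<forall>v\<in>C. u \<noteq> v \<longrightarrow> {u, v} \<in> \<Delta>)"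

text \<open>The complex \<open>{{}}\<close> has dimension \<open>-1\<close>. The void complex \<open>{}\<close> conventionally has
  dimension minus infinity; the value \<open>-2\<close> stands in for it (any value below \<open>-1\<close> makes
  the void complex subflag).\<close>

definition complex_dim :: "'a set set \<Rightarrow> int" where
  "complex_dim \<Delta> = (if \<Delta> = {} then - 2 else int (Max (card ` \<Delta>)) - 1)"

definition subflag :: "'a set set \<Rightarrow> bool" where
  "subflag \<Delta> \<longleftrightarrow> (\<forall>C. clique \<Delta> C \<and> int (card C) \<le> complex_dim \<Delta> + 1 \<longrightarrow> C \<in> \<Delta>)"

text \<open>The dual is taken relative to the ground set \<open>{1..n}\<close>; not every element of the ground
  set need be a vertex of the dual.\<close>

definition alexander_dual :: "nat \<Rightarrow> nat set set \<Rightarrow> nat set set" where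
  "alexander_dual n \<Delta> = {F. F \<subseteq> {1..n} \<and> {1..n} - F \<notin> \<Delta>}"

definition facet :: "'a set set \<Rightarrow> 'a set \<Rightarrow> bool" where
  "facet \<Gamma> F \<longleftrightarrow> F \<in> \<Gamma> \<and> (\<forall>G\<in>\<Gamma>. F \<subseteq> G \<longrightarrow> G = F)"

definition face_link :: "'a \<Rightarrow> 'a set set \<Rightarrow> 'a set set" where
  "face_link v \<Gamma> = {F. v \<notin> F \<and> insert v F \<in> \<Gamma>}"

definition face_del :: "'a \<Rightarrow> 'a set set \<Rightarrow> 'a set set" where
  "face_del v \<Gamma> = {F \<in> \<Gamma>. v \<notin> F}"

definition shedding :: "'a \<Rightarrow> 'a set set \<Rightarrow> bool" where
  "shedding v \<Gamma> \<longleftrightarrow>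
     v \<in> vertices \<Gamma> \<and> (\<forall>F. \<not> (facet (face_link v \<Gamma>) F \<and> facet (face_del v \<Gamma>) F))"

inductive vertex_decomposable :: "'a set set \<Rightarrow> bool" where
  simplex: "finite V \<Longrightarrow> vertex_decomposable (Pow V)"
| empty_face: "vertex_decomposable {{}}"
| void: "vertex_decomposable {}"
| shed: "\<lbrakk>abstract_simplicial_complex \<Gamma>; shedding v \<Gamma>;
     vertex_decomposable (face_del v \<Gamma>); vertex_decomposable (face_link v \<Gamma>)\<rbrakk>
     \<Longrightarrow> vertex_decomposable \<Gamma>"

end

theory Submission
  imports Defs
begin

text \<open>
  Alexander duality over a ground set \<open>V\<close> exchanges links and deletions, and turns facets into
  minimal non-faces. Hence \<open>v\<close> is a shedding vertex of the dual iff \<open>V - {v}\<close> is not a face of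
  \<open>\<Delta>\<close> and every \<open>N \<subseteq> V - {v}\<close>, all of whose exchanges \<open>N - {x} \<union> {v}\<close> are faces, is a face.

  (i) In a skeleton-E-chordal complex all of whose ground elements are vertices, the vertex of
  largest label has this exchange property, which is then exactly the chordality condition for two
  of the exchanges; chordality passes to links and deletions of this vertex. Links may lose
  vertices, but ground elements that are not vertices also have the exchange property.

  (ii) For \<open>N\<close> of size two, the exchange property says that the neighbours of \<open>v\<close> are pairwise
  adjacent. So a shedding order of the dual yields a perfect elimination order of the 1-skeleton.
\<close>

text \<open>The ground set is a parameter because the inductions remove elements from it, and a link
  may have fewer vertices than the ground set in which it is dualised.\<close>

definition dual_on :: "'a set \<Rightarrow> 'a set set \<Rightarrow> 'a set set" where
  "dual_on V \<Delta> = {F. F \<subseteq> V \<and> V - F \<notin> \<Delta>}"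

text \<open>No bijectivity is imposed on \<open>l\<close>, so that one labeling serves unchanged for
  all links and deletions met in the induction.\<close>

definition E_chordal_labeling :: "('a \<Rightarrow> nat) \<Rightarrow> 'a set set \<Rightarrow> bool" where
  "E_chordal_labeling l \<Delta> \<longleftrightarrow>
     (\<forall>f\<in>\<Delta>. \<forall>g\<in>\<Delta>. f \<noteq> g \<and> card f = card g \<and> Max (l ` f) = Max (l ` g) \<longrightarrow>
        (\<forall>h. h \<subseteq> f \<union> g \<and> card h = card f \<longrightarrow> h \<in> \<Delta>))"

text \<open>On a complex, this is a perfect elimination order of the 1-skeleton, read from the
  largest label downwards. The case \<open>a = b\<close> asks only for \<open>{a}\<close>, a subset
  of the face \<open>{a, c}\<close>.\<close>

definition elimination_labeling :: "('a \<Rightarrow> nat) \<Rightarrow> 'a set \<Rightarrow> 'a set set \<Rightarrow> bool" where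
  "elimination_labeling l V \<Delta> \<longleftrightarrow>
     (\<forall>c\<in>V. \<forall>a\<in>V. \<forall>b\<in>V. l a < l c \<and> l b < l c \<and> {a, c} \<in> \<Delta> \<and> {b, c} \<in> \<Delta> \<longrightarrow> {a, b} \<in> \<Delta>)"

section \<open>Closure properties of complexes, links and deletions\<close>

lemma complex_subset:
  assumes "abstract_simplicial_complex \<Delta>" "F \<in> \<Delta>" "G \<subseteq> F"
  shows "G \<in> \<Delta>"
  using assms unfolding abstract_simplicial_complex_def by blast

lemma complex_finite_face:
  assumes "abstract_simplicial_complex \<Delta>" "F \<in> \<Delta>"
  shows "finite F"
  using assms unfolding abstract_simplicial_complex_def by blast

lemma complex_face_del:
  assumes "abstract_simplicial_complex \<Delta>"
  shows "abstract_simplicial_complex (face_del v \<Delta>)"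
  using assms unfolding abstract_simplicial_complex_def face_del_def by (auto simp: subset_iff)

lemma complex_face_link:
  assumes "abstract_simplicial_complex \<Delta>"
  shows "abstract_simplicial_complex (face_link v \<Delta>)"
proof -
  have sub: "face_link v \<Delta> \<subseteq> \<Delta>"
    unfolding face_link_def using complex_subset[OF assms] by blast
  moreover have "finite \<Delta>" using assms unfolding abstract_simplicial_complex_def by simp
  ultimately have "finite (face_link v \<Delta>)" using finite_subset by metis
  moreover have "finite F" if "F \<in> face_link v \<Delta>" for F
    using complex_finite_face[OF assms] that sub by (simp add: subset_iff)
  moreover have "G \<in> face_link v \<Delta>" if "F \<in> face_link v \<Delta>" "G \<subseteq> F" for F G
    using that complex_subset[OF assms, of "insert v F" "insert v G"] unfolding face_link_def by auto
  ultimately show ?thesis unfolding abstract_simplicial_complex_def by simp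
qed

section \<open>Alexander duality over an arbitrary ground set\<close>

lemma complex_dual_on:
  assumes "abstract_simplicial_complex \<Delta>" "finite V"
  shows "abstract_simplicial_complex (dual_on V \<Delta>)"
proof -
  have "dual_on V \<Delta> \<subseteq> Pow V" unfolding dual_on_def by blast
  then have "finite (dual_on V \<Delta>)" using assms(2) finite_subset by (metis finite_Pow_iff)
  moreover have "finite F" if "F \<in> dual_on V \<Delta>" for F
    using that assms(2) finite_subset unfolding dual_on_def by auto
  moreover have "G \<in> dual_on V \<Delta>" if "F \<in> dual_on V \<Delta>" "G \<subseteq> F" for F G
    using that complex_subset[OF assms(1), of "V - G" "V - F"] unfolding dual_on_def by auto
  ultimately show ?thesis unfolding abstract_simplicial_complex_def by simp
qed

text \<open>The complement in \<open>V\<close> of a set containing \<open>v\<close> avoids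
  \<open>v\<close>, so it is tested in the deletion; the complement of a set avoiding
  \<open>v\<close> contains \<open>v\<close>, so it is tested in the link. Hence the exchange of
  roles here and in the next lemma.\<close>

lemma face_link_dual_on:
  assumes "v \<in> V"
  shows "face_link v (dual_on V \<Delta>) = dual_on (V - {v}) (face_del v \<Delta>)"
proof -
  have "V - {v} - F = V - insert v F" for F by blast
  then have "F \<in> face_link v (dual_on V \<Delta>) \<longleftrightarrow> F \<in> dual_on (V - {v}) (face_del v \<Delta>)" for F
    using assms by (simp only: face_link_def face_del_def dual_on_def mem_Collect_eq) blast
  then show ?thesis by (rule set_eqI)
qed

lemma face_del_dual_on:
  assumes "v \<in> V"
  shows "face_del v (dual_on V \<Delta>) = dual_on (V - {v}) (face_link v \<Delta>)"
proof -
  have "F \<in> face_del v (dual_on V \<Delta>) \<longleftrightarrow> F \<in> dual_on (V - {v}) (face_link v \<Delta>)" for F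
  proof (cases "F \<subseteq> V - {v}")
    case True
    then have "insert v (V - {v} - F) = V - F" using assms by blast
    then show ?thesis using True unfolding face_link_def face_del_def dual_on_def by auto
  qed (auto simp: face_del_def dual_on_def)
  then show ?thesis by (rule set_eqI)
qed

text \<open>Removing \<open>x\<close> from \<open>N\<close> adds \<open>x\<close> to the complement.
  By closure under subsets, minimality of a non-face can be tested on such single removals.\<close>

lemma facet_dual_on_iff:
  assumes "abstract_simplicial_complex \<Delta>" "N \<subseteq> V"
  shows "facet (dual_on V \<Delta>) (V - N) \<longleftrightarrow> N \<notin> \<Delta> \<and> (\<forall>x\<in>N. N - {x} \<in> \<Delta>)"
proof -
  have VN: "V - (V - N) = N" using assms(2) by blast
  have "(\<forall>G\<in>dual_on V \<Delta>. V - N \<subseteq> G \<longrightarrow> G = V - N) \<longleftrightarrow> (\<forall>x\<in>N. N - {x} \<in> \<Delta>)"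
  proof (intro iffI ballI impI)
    fix x assume *: "\<forall>G\<in>dual_on V \<Delta>. V - N \<subseteq> G \<longrightarrow> G = V - N" and x: "x \<in> N"
    show "N - {x} \<in> \<Delta>"
    proof (rule ccontr)
      assume n: "N - {x} \<notin> \<Delta>"
      have "V - insert x (V - N) = N - {x}" using assms(2) by blast
      then have "insert x (V - N) \<in> dual_on V \<Delta>"
        using n x assms(2) unfolding dual_on_def by auto
      then show False using * x by blast
    qed
  next
    fix G assume *: "\<forall>x\<in>N. N - {x} \<in> \<Delta>" and G: "G \<in> dual_on V \<Delta>" "V - N \<subseteq> G"
    show "G = V - N"
    proof (rule ccontr)
      assume "G \<noteq> V - N"
      then obtain x where x: "x \<in> G" "x \<in> N" using G unfolding dual_on_def by blast
      then have "V - G \<subseteq> N - {x}" using G by blast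
      then have "V - G \<in> \<Delta>" using complex_subset[OF assms(1)] * x by blast
      then show False using G unfolding dual_on_def by blast
    qed
  qed
  moreover have "V - N \<in> dual_on V \<Delta> \<longleftrightarrow> N \<notin> \<Delta>" unfolding dual_on_def by (simp add: VN)
  ultimately show ?thesis unfolding facet_def by simp
qed

text \<open>A common facet of link and deletion is \<open>V - {v} - N\<close> with \<open>N\<close>
  a minimal non-face of both \<open>face_del v \<Delta>\<close> and
  \<open>face_link v \<Delta>\<close>. Since \<open>N \<notin> \<Delta>\<close> implies
  \<open>insert v N \<notin> \<Delta>\<close>, and \<open>insert v (N - {x}) \<in> \<Delta>\<close>
  implies \<open>N - {x} \<in> \<Delta>\<close>, the two minimality conditions merge into one. The
  clause \<open>V - {v} \<notin> \<Delta>\<close> says that \<open>v\<close> is a vertex of the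
  dual.\<close>

lemma shedding_dual_on_iff:
  assumes \<Delta>: "abstract_simplicial_complex \<Delta>" and v: "v \<in> V"
  shows "shedding v (dual_on V \<Delta>) \<longleftrightarrow>
    V - {v} \<notin> \<Delta> \<and> (\<forall>N\<subseteq>V - {v}. (\<forall>x\<in>N. insert v (N - {x}) \<in> \<Delta>) \<longrightarrow> N \<in> \<Delta>)"
proof -
  let ?L = "face_link v (dual_on V \<Delta>)" and ?D = "face_del v (dual_on V \<Delta>)"
  have *: "facet ?L (V - {v} - N) \<and> facet ?D (V - {v} - N) \<longleftrightarrow>
      N \<notin> \<Delta> \<and> (\<forall>x\<in>N. insert v (N - {x}) \<in> \<Delta>)" if N: "N \<subseteq> V - {v}" for N
  proof -
    have "N \<in> \<Delta>" if "insert v N \<in> \<Delta>" using complex_subset[OF \<Delta> that] by blast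
    moreover have "N - {x} \<in> \<Delta>" if "insert v (N - {x}) \<in> \<Delta>" for x
      using complex_subset[OF \<Delta> that] by blast
    ultimately show ?thesis
      unfolding face_link_dual_on[OF v] face_del_dual_on[OF v]
        facet_dual_on_iff[OF complex_face_del[OF \<Delta>] N]
        facet_dual_on_iff[OF complex_face_link[OF \<Delta>] N]
      using N unfolding face_link_def face_del_def by blast
  qed
  have reindex: "(\<forall>F. \<not> (facet ?L F \<and> facet ?D F)) \<longleftrightarrow>
      (\<forall>N\<subseteq>V - {v}. \<not> (facet ?L (V - {v} - N) \<and> facet ?D (V - {v} - N)))"
  proof (intro iffI allI impI)
    fix F assume h: "\<forall>N\<subseteq>V - {v}. \<not> (facet ?L (V - {v} - N) \<and> facet ?D (V - {v} - N))"
    show "\<not> (facet ?L F \<and> facet ?D F)"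
    proof
      assume F: "facet ?L F \<and> facet ?D F"
      then have "F \<subseteq> V - {v}" unfolding facet_def face_del_def dual_on_def by blast
      then have "V - {v} - (V - {v} - F) = F" by blast
      then show False using h F by (metis Diff_subset)
    qed
  qed blast
  have "v \<in> vertices (dual_on V \<Delta>) \<longleftrightarrow> V - {v} \<notin> \<Delta>"
    using v unfolding vertices_def dual_on_def by simp
  moreover have "(\<forall>F. \<not> (facet ?L F \<and> facet ?D F)) \<longleftrightarrow>
      (\<forall>N\<subseteq>V - {v}. (\<forall>x\<in>N. insert v (N - {x}) \<in> \<Delta>) \<longrightarrow> N \<in> \<Delta>)"
    unfolding reindex by (intro all_cong) (use * in metis)
  ultimately show ?thesis unfolding shedding_def by simp
qed

section \<open>E-chordal labelings and decomposability of the dual\<close>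

lemma E_chordal_labelingD:
  assumes "E_chordal_labeling l \<Delta>" "f \<in> \<Delta>" "g \<in> \<Delta>" "f \<noteq> g" "card f = card g"
    "Max (l ` f) = Max (l ` g)" "h \<subseteq> f \<union> g" "card h = card f"
  shows "h \<in> \<Delta>"
  using assms unfolding E_chordal_labeling_def by blast

lemma E_chordal_labeling_face_del:
  assumes "E_chordal_labeling l \<Delta>"
  shows "E_chordal_labeling l (face_del v \<Delta>)"
  unfolding E_chordal_labeling_def
proof (intro ballI allI impI, elim conjE)
  fix f g h
  assume a: "f \<in> face_del v \<Delta>" "g \<in> face_del v \<Delta>" "f \<noteq> g" "card f = card g"
    "Max (l ` f) = Max (l ` g)" "h \<subseteq> f \<union> g" "card h = card f"
  then have "h \<in> \<Delta>"
    using E_chordal_labelingD[OF assms, of f g h] by (simp add: face_del_def)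
  then show "h \<in> face_del v \<Delta>" using a unfolding face_del_def by blast
qed

lemma Max_image_insert_top:
  fixes l :: "'a \<Rightarrow> nat"
  assumes "finite F" "\<And>u. u \<in> F \<Longrightarrow> l u \<le> l v"
  shows "Max (l ` insert v F) = l v"
  using assms by (intro Max_eqI) auto

text \<open>Adding \<open>v\<close> to \<open>f\<close>, \<open>g\<close> and \<open>h\<close>
  raises all sizes by one and gives both enlarged faces the maximum \<open>l v\<close>, so
  chordality of \<open>\<Delta>\<close> applies to them.\<close>

lemma E_chordal_labeling_face_link_top:
  assumes \<Delta>: "abstract_simplicial_complex \<Delta>" and E: "E_chordal_labeling l \<Delta>"
    and V: "\<Delta> \<subseteq> Pow V" and top: "\<And>u. u \<in> V \<Longrightarrow> l u \<le> l v"
  shows "E_chordal_labeling l (face_link v \<Delta>)"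
  unfolding E_chordal_labeling_def
proof (intro ballI allI impI, elim conjE)
  fix f g h
  assume a: "f \<in> face_link v \<Delta>" "g \<in> face_link v \<Delta>" "f \<noteq> g" "card f = card g"
    "Max (l ` f) = Max (l ` g)" "h \<subseteq> f \<union> g" "card h = card f"
  have fin: "finite f" "finite g"
    using a(1,2) complex_finite_face[OF complex_face_link[OF \<Delta>]] by blast+
  then have "finite h" using a(6) finite_subset by blast
  have v: "v \<notin> f" "v \<notin> g" "v \<notin> h" and F: "insert v f \<in> \<Delta>" "insert v g \<in> \<Delta>"
    using a unfolding face_link_def by auto
  have "Max (l ` insert v f) = l v" "Max (l ` insert v g) = l v"
    using F V top fin by (intro Max_image_insert_top; blast)+
  moreover have "insert v f \<noteq> insert v g" using v a(3) by (simp add: insert_ident)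
  ultimately have "insert v h \<in> \<Delta>"
    using v a fin \<open>finite h\<close> F by (intro E_chordal_labelingD[OF E F]) auto
  then show "h \<in> face_link v \<Delta>" using v unfolding face_link_def by blast
qed

text \<open>For distinct \<open>x\<close> and \<open>y\<close> in \<open>N\<close>, the exchanges
  are distinct faces of size \<open>card N\<close> with maximum \<open>l v\<close>, and their union
  contains \<open>N\<close>. Sets \<open>N\<close> with at most one element are faces by
  assumption.\<close>

lemma exchange_top:
  assumes \<Delta>: "abstract_simplicial_complex \<Delta>" and E: "E_chordal_labeling l \<Delta>"
    and V: "\<Delta> \<subseteq> Pow V" and top: "\<And>u. u \<in> V \<Longrightarrow> l u \<le> l v"
    and vert: "\<And>u. u \<in> V \<Longrightarrow> {u} \<in> \<Delta>" and "{} \<in> \<Delta>"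
    and N: "N \<subseteq> V - {v}" and exch: "\<And>x. x \<in> N \<Longrightarrow> insert v (N - {x}) \<in> \<Delta>"
  shows "N \<in> \<Delta>"
proof (cases "\<exists>x\<in>N. \<exists>y\<in>N. x \<noteq> y")
  case True
  then obtain x y where xy: "x \<in> N" "y \<in> N" "x \<noteq> y" by blast
  let ?f = "insert v (N - {x})" and ?g = "insert v (N - {y})"
  have fin: "finite N" using complex_finite_face[OF \<Delta> exch[OF xy(1)]] by simp
  have "v \<notin> N" using N by blast
  then have card: "card ?f = card N" "card ?g = card N"
    using fin xy by (simp_all add: card_Suc_Diff1 del: card_Diff_insert card_Diff_singleton)
  have "Max (l ` ?f) = l v" "Max (l ` ?g) = l v"
    using N top fin by (intro Max_image_insert_top; blast)+
  then show ?thesis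
    using card xy \<open>v \<notin> N\<close> by (intro E_chordal_labelingD[OF E exch[OF xy(1)] exch[OF xy(2)]]) auto
next
  case False
  then consider "N = {}" | x where "x \<in> N" "N = {x}" by blast
  then show ?thesis using assms(6) vert N by cases auto
qed

text \<open>Elements of \<open>V\<close> need not be vertices, which keeps the statement stable
  under links. The induction is on \<open>card V\<close>, with \<open>l\<close> fixed.\<close>

theorem vertex_decomposable_dual_on:
  assumes "finite V" "abstract_simplicial_complex \<Delta>" "\<Delta> \<subseteq> Pow V" "E_chordal_labeling l \<Delta>"
  shows "vertex_decomposable (dual_on V \<Delta>)"
  using assms
proof (induction "card V" arbitrary: V \<Delta> rule: less_induct)
  case (less V \<Delta>)
  note \<Delta> = less.prems(2) and V = less.prems(3) and E = less.prems(4)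
  show ?case
  proof (cases "\<Delta> = {} \<or> V = {}")
    case True
    then have "dual_on V \<Delta> = Pow V \<or> dual_on V \<Delta> = {}"
      using V unfolding dual_on_def by auto
    then show ?thesis
      using vertex_decomposable.simplex[OF less.prems(1)] vertex_decomposable.void by auto
  next
    case False
    then have e: "{} \<in> \<Delta>" using complex_subset[OF \<Delta>] by blast
    obtain v where v: "v \<in> V"
      and exch: "\<And>N. \<lbrakk>N \<subseteq> V - {v}; \<And>x. x \<in> N \<Longrightarrow> insert v (N - {x}) \<in> \<Delta>\<rbrakk> \<Longrightarrow> N \<in> \<Delta>"
      and link: "E_chordal_labeling l (face_link v \<Delta>)"
    proof (cases "\<forall>u\<in>V. {u} \<in> \<Delta>")
      case True
      have "Max (l ` V) \<in> l ` V" using False less.prems(1) by simp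
      then obtain v where v: "v \<in> V" "l v = Max (l ` V)" by auto
      then have top: "\<And>u. u \<in> V \<Longrightarrow> l u \<le> l v" using less.prems(1) by simp
      show ?thesis
        using that[OF v(1)] exchange_top[OF \<Delta> E V top _ e] True
          E_chordal_labeling_face_link_top[OF \<Delta> E V top] by blast
    next
      case False
      then obtain v where v: "v \<in> V" "{v} \<notin> \<Delta>" by blast
      \<comment> \<open>No face contains \<open>v\<close>, so its link is void and no nonempty
        \<open>N\<close> has its exchanges in \<open>\<Delta>\<close>.\<close>
      then have no: "\<And>F. insert v F \<notin> \<Delta>" using complex_subset[OF \<Delta>] by blast
      show ?thesis
      proof (rule that[OF v(1)])
        show "E_chordal_labeling l (face_link v \<Delta>)"
          unfolding E_chordal_labeling_def face_link_def using no by blast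
        show "N \<in> \<Delta>" if "\<And>x. x \<in> N \<Longrightarrow> insert v (N - {x}) \<in> \<Delta>" for N
          using that no e by (cases "N = {}") auto
      qed
    qed
    have card: "card (V - {v}) < card V" using card_Diff1_less[OF less.prems(1) v] .
    \<comment> \<open>The names refer to \<open>\<Delta>\<close>: the deletion of the dual is the
      dual of the link, and conversely.\<close>
    have IHl: "vertex_decomposable (face_del v (dual_on V \<Delta>))"
      unfolding face_del_dual_on[OF v]
      using V less.prems(1)
      by (intro less.hyps[OF card _ complex_face_link[OF \<Delta>] _ link]) (auto simp: face_link_def)
    have IHd: "vertex_decomposable (face_link v (dual_on V \<Delta>))"
      unfolding face_link_dual_on[OF v]
      using V less.prems(1)
      by (intro less.hyps[OF card _ complex_face_del[OF \<Delta>] _ E_chordal_labeling_face_del[OF E]])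
        (auto simp: face_del_def)
    show ?thesis
    proof (cases "V - {v} \<in> \<Delta>")
      \<comment> \<open>Here \<open>v\<close> is not a vertex of the dual and cannot be shed, but
        the dual equals its own deletion, which is covered by induction.\<close>
      case True
      have "v \<notin> F" if "F \<in> dual_on V \<Delta>" for F
        using that complex_subset[OF \<Delta> True, of "V - F"] unfolding dual_on_def by blast
      then have "face_del v (dual_on V \<Delta>) = dual_on V \<Delta>" unfolding face_del_def by blast
      then show ?thesis using IHl by simp
    next
      case False
      then have "shedding v (dual_on V \<Delta>)" using exch shedding_dual_on_iff[OF \<Delta> v] by blast
      from vertex_decomposable.shed[OF complex_dual_on[OF \<Delta> less.prems(1)] this IHl IHd]
      show ?thesis .
    qed
  qed
qed

section \<open>Elimination orders from decomposability of the dual\<close>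

lemma neighbours_adjacent_of_shedding:
  assumes \<Delta>: "abstract_simplicial_complex \<Delta>" and v: "v \<in> V"
    and shed: "shedding v (dual_on V \<Delta>)"
    and ab: "a \<in> V - {v}" "b \<in> V - {v}" "{a, v} \<in> \<Delta>" "{b, v} \<in> \<Delta>"
  shows "{a, b} \<in> \<Delta>"
proof -
  have "insert v ({a, b} - {x}) \<in> \<Delta>" if "x \<in> {a, b}" for x
  proof -
    \<comment> \<open>Only inclusions hold in general: for \<open>a = b\<close> the exchange is
      \<open>{v}\<close>.\<close>
    have "insert v ({a, b} - {x}) \<subseteq> {a, v} \<or> insert v ({a, b} - {x}) \<subseteq> {b, v}"
      using that by blast
    then show ?thesis using complex_subset[OF \<Delta>] ab by blast
  qed
  moreover have "{a, b} \<subseteq> V - {v}" using ab by blast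
  ultimately show ?thesis using shed unfolding shedding_dual_on_iff[OF \<Delta> v] by metis
qed

lemma bij_betw_extend_top:
  assumes "finite V" "v \<in> V" "bij_betw l (V - {v}) {1..card (V - {v})}"
  shows "bij_betw (l(v := card V)) V {1..card V}"
proof -
  have c: "card V = Suc (card (V - {v}))" using assms card_Suc_Diff1 by metis
  have "bij_betw (l(v := card V)) (V - {v}) {1..card (V - {v})}"
    using assms(3) by (subst bij_betw_cong[where g = l]) auto
  then have "bij_betw (l(v := card V)) (insert v (V - {v})) (insert (card V) {1..card (V - {v})})"
    using c by (subst insert_is_Un, subst (2) insert_is_Un, intro bij_betw_combine)
      (auto simp: bij_betw_def)
  moreover have "insert (card V) {1..card (V - {v})} = {1..card V}" using c by auto
  ultimately show ?thesis using assms(2) by (simp add: insert_absorb)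
qed

lemma elimination_labeling_extend_top:
  assumes V: "finite V" "v \<in> V"
    and bij: "bij_betw l (V - {v}) {1..card (V - {v})}"
    and l: "elimination_labeling l (V - {v}) (face_del v \<Delta>)"
    and adj: "\<And>a b. \<lbrakk>a \<in> V - {v}; b \<in> V - {v}; {a, v} \<in> \<Delta>; {b, v} \<in> \<Delta>\<rbrakk> \<Longrightarrow> {a, b} \<in> \<Delta>"
  shows "elimination_labeling (l(v := card V)) V \<Delta>"
  unfolding elimination_labeling_def
proof (intro ballI impI, elim conjE)
  fix a b c
  let ?l = "l(v := card V)"
  assume abc: "c \<in> V" "a \<in> V" "b \<in> V" "?l a < ?l c" "?l b < ?l c" "{a, c} \<in> \<Delta>" "{b, c} \<in> \<Delta>"
  \<comment> \<open>Since \<open>v\<close> has the largest label, \<open>a\<close> and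
    \<open>b\<close>, lying strictly below \<open>c\<close>, differ from \<open>v\<close>.\<close>
  have "?l c \<le> card V"
    using bij_betw_apply[OF bij_betw_extend_top[OF V bij] abc(1)] by simp
  then have ab: "a \<in> V - {v}" "b \<in> V - {v}" using abc by auto
  show "{a, b} \<in> \<Delta>"
  proof (cases "c = v")
    case True
    then show ?thesis using adj ab abc by blast
  next
    case False
    then have "l a < l c" "l b < l c" "{a, c} \<in> face_del v \<Delta>" "{b, c} \<in> face_del v \<Delta>"
      using abc ab by (auto simp: face_del_def)
    then have "{a, b} \<in> face_del v \<Delta>"
      using l abc(1) ab False unfolding elimination_labeling_def by blast
    then show ?thesis unfolding face_del_def by blast
  qed
qed

lemma exists_elimination_labeling_complete:
  assumes V: "finite V" and adj: "\<And>a b. \<lbrakk>a \<in> V; b \<in> V\<rbrakk> \<Longrightarrow> {a, b} \<in> \<Delta>"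
  shows "\<exists>l. bij_betw l V {1..card V} \<and> elimination_labeling l V \<Delta>"
  using ex_bij_betw_finite_nat[OF V] finite_same_card_bij[OF V, of "{1..card V}"] adj
  unfolding elimination_labeling_def by auto

text \<open>The dual is \<open>Pow W\<close> exactly if the unique minimal non-face is \<open>V - W\<close>. If \<open>V - W\<close> has two
  elements, the 1-skeleton misses exactly this edge, and either end may be eliminated first.\<close>

lemma exists_elimination_labeling_dual_simplex:
  assumes V: "finite V" and vert: "\<And>u. u \<in> V \<Longrightarrow> {u} \<in> \<Delta>" and dual: "dual_on V \<Delta> = Pow W"
  shows "\<exists>l. bij_betw l V {1..card V} \<and> elimination_labeling l V \<Delta>"
proof (cases "\<forall>a\<in>V. \<forall>b\<in>V. {a, b} \<in> \<Delta>")
  case True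
  then show ?thesis using exists_elimination_labeling_complete[OF V] by blast
next
  case False
  have face: "G \<in> \<Delta> \<longleftrightarrow> \<not> V - W \<subseteq> G" if "G \<subseteq> V" for G
  proof -
    have "V - (V - G) = G" using that by blast
    then have "G \<notin> \<Delta> \<longleftrightarrow> V - G \<in> dual_on V \<Delta>" unfolding dual_on_def by auto
    then show ?thesis unfolding dual by blast
  qed
  obtain v w where vw: "v \<in> V" "w \<in> V" "{v, w} \<notin> \<Delta>" using False by blast
  \<comment> \<open>Singletons are faces, so \<open>V - W\<close> is exactly \<open>{v, w}\<close>;
    a pair avoiding \<open>v\<close> cannot contain it and hence is a face.\<close>
  then have "V - W \<subseteq> {v, w}" "v \<in> V - W" "w \<in> V - W"
    using face[of "{v, w}"] face[of "{v}"] face[of "{w}"] vert by auto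
  then have adj: "{a, b} \<in> \<Delta>" if "a \<in> V - {v}" "b \<in> V - {v}" for a b
    using that face[of "{a, b}"] by blast
  then have "{a, b} \<in> face_del v \<Delta>" if "a \<in> V - {v}" "b \<in> V - {v}" for a b
    using that unfolding face_del_def by blast
  then obtain l where "bij_betw l (V - {v}) {1..card (V - {v})}"
    "elimination_labeling l (V - {v}) (face_del v \<Delta>)"
    using exists_elimination_labeling_complete[of "V - {v}" "face_del v \<Delta>"] V by blast
  then show ?thesis
    using bij_betw_extend_top[OF V vw(1)] elimination_labeling_extend_top[OF V vw(1)] adj by blast
qed

text \<open>The induction descends along the link of the dual, that is, the deletion of
  \<open>\<Delta>\<close>, which keeps every element of \<open>V - {v}\<close> as a vertex. The
  shedding vertex gets the top label.\<close>

theorem exists_elimination_labeling: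
  assumes "vertex_decomposable \<Gamma>" "finite V" "abstract_simplicial_complex \<Delta>"
    "\<And>u. u \<in> V \<Longrightarrow> {u} \<in> \<Delta>" "dual_on V \<Delta> = \<Gamma>"
  shows "\<exists>l. bij_betw l V {1..card V} \<and> elimination_labeling l V \<Delta>"
  using assms
proof (induction arbitrary: V \<Delta> rule: vertex_decomposable.induct)
  case (simplex W)
  then show ?case using exists_elimination_labeling_dual_simplex by metis
next
  case empty_face
  then show ?case using exists_elimination_labeling_dual_simplex[of V \<Delta> "{}"] by simp
next
  case void
  have "{} \<notin> dual_on V \<Delta>" using void.prems(4) by simp
  then have "V \<in> \<Delta>" by (simp add: dual_on_def)
  then have "\<And>a b. \<lbrakk>a \<in> V; b \<in> V\<rbrakk> \<Longrightarrow> {a, b} \<in> \<Delta>"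
    using complex_subset[OF void.prems(2)] by simp
  then show ?case by (rule exists_elimination_labeling_complete[OF void.prems(1)])
next
  case (shed \<Gamma> v)
  note V = shed.prems(1) and \<Delta> = shed.prems(2) and vert = shed.prems(3)
  have "{v} \<in> \<Gamma>" using shed.hyps(2) unfolding shedding_def vertices_def by blast
  then have "{v} \<in> dual_on V \<Delta>" using shed.prems(4) by simp
  then have v: "v \<in> V" by (simp add: dual_on_def)
  have "\<exists>l. bij_betw l (V - {v}) {1..card (V - {v})} \<and>
      elimination_labeling l (V - {v}) (face_del v \<Delta>)"
  proof (rule shed.IH(2))
    show "dual_on (V - {v}) (face_del v \<Delta>) = face_link v \<Gamma>"
      using face_link_dual_on[OF v, of \<Delta>] shed.prems(4) by simp
    show "abstract_simplicial_complex (face_del v \<Delta>)" by (rule complex_face_del[OF \<Delta>])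
  qed (use V vert in \<open>auto simp: face_del_def\<close>)
  then obtain l where l: "bij_betw l (V - {v}) {1..card (V - {v})}"
    "elimination_labeling l (V - {v}) (face_del v \<Delta>)" by blast
  have "shedding v (dual_on V \<Delta>)" using shed.hyps(2) shed.prems(4) by simp
  note neighbours_adjacent_of_shedding[OF \<Delta> v this]
  then have "elimination_labeling (l(v := card V)) V \<Delta>"
    by (rule elimination_labeling_extend_top[OF V v l])
  then show ?case using bij_betw_extend_top[OF V v l(1)] by blast
qed

section \<open>From elimination orders to the chordality conditions\<close>

lemma skeleton_clique_chordal_of_elimination_labeling:
  assumes \<Delta>: "abstract_simplicial_complex \<Delta>"
    and l: "vertex_labeling \<Delta> l" "elimination_labeling l (vertices \<Delta>) \<Delta>"
  shows "skeleton_clique_chordal \<Delta>"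
proof -
  have inj: "inj_on l (vertices \<Delta>)" using l(1) unfolding vertex_labeling_def bij_betw_def by blast
  have sub: "f \<subseteq> vertices \<Delta>" if "f \<in> \<Delta>" for f
    using complex_subset[OF \<Delta> that] unfolding vertices_def by blast
  have "e \<in> \<Delta>" if fg: "f \<in> \<Delta>" "g \<in> \<Delta>" and card: "card f = card g" "card f \<ge> 2"
      and Max: "Max (l ` f) = Max (l ` g)" and e: "e \<subseteq> f \<union> g" "card e = 2" for f g e
  proof -
    have fin: "finite f" "finite g" using complex_finite_face[OF \<Delta>] fg by blast+
    have "f \<noteq> {}" "g \<noteq> {}" using card by auto
    then have "Max (l ` f) \<in> l ` f" "Max (l ` g) \<in> l ` g" using fin by simp_all
    then obtain c d where cd: "c \<in> f" "l c = Max (l ` f)" "d \<in> g" "l d = Max (l ` g)" by auto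
    \<comment> \<open>By injectivity, equal maximal labels mean a common top vertex; all other
      vertices of \<open>f \<union> g\<close> are neighbours of it with smaller labels.\<close>
    then have "c = d" using Max inj_onD[OF inj, of c d] sub fg by auto
    then have c: "c \<in> f" "c \<in> g" using cd by auto
    obtain a b where ab: "e = {a, b}" using e(2) by (auto simp: card_2_iff)
    have le: "l u \<le> l c" if "u \<in> f \<union> g" for u
      using that cd Max Max_ge[of "l ` f" "l u"] Max_ge[of "l ` g" "l u"] fin by auto
    have edge: "{u, c} \<in> \<Delta>" if "u \<in> f \<union> g" for u
    proof -
      have "{u, c} \<subseteq> f \<or> {u, c} \<subseteq> g" using that c by blast
      then show ?thesis using complex_subset[OF \<Delta>] fg by blast
    qed
    have V: "f \<union> g \<subseteq> vertices \<Delta>" using sub fg by blast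
    have abfg: "a \<in> f \<union> g" "b \<in> f \<union> g" using e(1) ab by auto
    show ?thesis
    proof (cases "a = c \<or> b = c")
      case True
      then show ?thesis using ab edge abfg by (metis insert_commute)
    next
      case False
      then have "l a \<noteq> l c" "l b \<noteq> l c" using inj abfg V c by (auto simp: inj_on_eq_iff subset_iff)
      then have "l a < l c" "l b < l c" using le abfg by (simp_all add: order_less_le)
      then show ?thesis
        using l(2) V abfg c edge unfolding elimination_labeling_def ab by blast
    qed
  qed
  then show ?thesis unfolding skeleton_clique_chordal_def using l(1) by blast
qed

text \<open>With the same labeling, \<open>h\<close> is a clique of size \<open>card f\<close>,
  which is at most the dimension plus one, so subflagness makes it a face.\<close>

lemma skeleton_E_chordal_of_clique_chordal:
  assumes \<Delta>: "abstract_simplicial_complex \<Delta>" and "subflag \<Delta>" "skeleton_clique_chordal \<Delta>"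
  shows "skeleton_E_chordal \<Delta>"
proof -
  obtain l where l: "vertex_labeling \<Delta> l"
    and ch: "\<And>f g e. \<lbrakk>f \<in> \<Delta>; g \<in> \<Delta>; f \<noteq> g; card f = card g; card f \<ge> 2;
        Max (l ` f) = Max (l ` g); e \<subseteq> f \<union> g; card e = 2\<rbrakk> \<Longrightarrow> e \<in> \<Delta>"
    using assms(3) unfolding skeleton_clique_chordal_def by metis
  have inj: "inj_on l (vertices \<Delta>)" using l unfolding vertex_labeling_def bij_betw_def by blast
  have sub: "f \<subseteq> vertices \<Delta>" if "f \<in> \<Delta>" for f
    using complex_subset[OF \<Delta> that] unfolding vertices_def by blast
  have "h \<in> \<Delta>" if fg: "f \<in> \<Delta>" "g \<in> \<Delta>" "f \<noteq> g" and card: "card f = card g"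
      and Max: "Max (l ` f) = Max (l ` g)" and h: "h \<subseteq> f \<union> g" "card h = card f" for f g h
  proof -
    have fin: "finite f" "finite g" using complex_finite_face[OF \<Delta>] fg by blast+
    have "card f \<noteq> 0" using fin card fg by auto
    \<comment> \<open>Distinct singletons have distinct labels, so equal maxima force size at least
      two, as clique-chordality requires.\<close>
    moreover have "card f \<noteq> 1"
    proof
      assume "card f = 1"
      then obtain u w where "f = {u}" "g = {w}" using card by (metis card_1_singletonE)
      then show False using Max inj_onD[OF inj, of u w] sub fg by auto
    qed
    ultimately have "card f \<ge> 2" by linarith
    then have "{u, w} \<in> \<Delta>" if "u \<in> h" "w \<in> h" "u \<noteq> w" for u w
      using ch[OF fg card _ Max, of "{u, w}"] that h(1) by auto
    moreover have "h \<subseteq> vertices \<Delta>" using h(1) sub[OF fg(1)] sub[OF fg(2)] by blast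
    ultimately have "clique \<Delta> h" unfolding clique_def by simp
    moreover have "card f \<le> Max (card ` \<Delta>)"
      using \<Delta> fg unfolding abstract_simplicial_complex_def by simp
    then have "int (card h) \<le> complex_dim \<Delta> + 1" using h(2) fg unfolding complex_dim_def by auto
    ultimately show ?thesis using assms(2) unfolding subflag_def by blast
  qed
  then show ?thesis unfolding skeleton_E_chordal_def using l by blast
qed

theorem theorem1:
  fixes n :: nat and \<Delta> :: "nat set set"
  assumes "complex_on n \<Delta>"
  shows "(skeleton_E_chordal \<Delta> \<longrightarrow> vertex_decomposable (alexander_dual n \<Delta>)) \<and>
         (vertex_decomposable (alexander_dual n \<Delta>) \<longrightarrow> skeleton_clique_chordal \<Delta>) \<and>
         (subflag \<Delta> \<longrightarrow> (skeleton_E_chordal \<Delta> \<longleftrightarrow> vertex_decomposable (alexander_dual n \<Delta>)))"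
proof -
  have \<Delta>: "abstract_simplicial_complex \<Delta>" and V: "vertices \<Delta> = {1..n}"
    using assms unfolding complex_on_def by blast+
  have sub: "\<Delta> \<subseteq> Pow {1..n}"
    using complex_subset[OF \<Delta>] V unfolding vertices_def by blast
  have dual: "alexander_dual n \<Delta> = dual_on {1..n} \<Delta>"
    unfolding alexander_dual_def dual_on_def ..
  have i: "vertex_decomposable (alexander_dual n \<Delta>)" if "skeleton_E_chordal \<Delta>"
    using that vertex_decomposable_dual_on[OF _ \<Delta> sub]
    unfolding dual skeleton_E_chordal_def E_chordal_labeling_def[symmetric] by blast
  have ii: "skeleton_clique_chordal \<Delta>" if "vertex_decomposable (alexander_dual n \<Delta>)"
  proof -
    have "\<exists>l. bij_betw l {1..n} {1..card {1..n}} \<and> elimination_labeling l {1..n} \<Delta>"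
      using that V sub \<Delta> dual
      by (intro exists_elimination_labeling[OF that]) (auto simp: vertices_def)
    then show ?thesis
      using skeleton_clique_chordal_of_elimination_labeling[OF \<Delta>] V
      unfolding vertex_labeling_def by metis
  qed
  \<comment> \<open>In the subflag case, (ii) followed by this lemma gives the converse of
    (i).\<close>
  show ?thesis using i ii skeleton_E_chordal_of_clique_chordal[OF \<Delta>] by blast
qed

end
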